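(* Let $\mathbf{P}\subset\mathbb{R}$ be the union of finitely many compact intervals, with $\overline{\operatorname{int}\mathbf{P}}=\mathbf{P}$, and assume that $0\in\mathbf{P}$. Let $A\in\mathbb{R}^{n\times n}$ and $B\in\mathbb{R}^{n\times m}$ be fixed matrices. The family $\Sigma=\{(\theta A,B)\;|\;\theta\in\mathbf{P}\}$ is uniformly ensemble controllable if and only if $\operatorname{rank}A=n$ and $\operatorname{rank}B=n$.
   Context: The family $\{(\theta A,B)\;|\;\theta\in\mathbf{P}\}$ is uniformly ensemble controllable if for every $x^*\in C(\mathbf{P},\mathbb{R}^n)$ and every $\varepsilon>0$ there exist $T>0$ and a $\theta$-independent input $u$ such that $\sup_{\theta\in\mathbf{P}}\|\varphi(T,\theta,u)-x^*(\theta)\|<\varepsilon$. In continuous time, $u\in L^1([0,T],\mathbb{R}^m)$ and $\varphi(T,\theta,u)=\int_0^Te^{\theta A(T-s)}Bu(s)\,ds$ (the solution at time $T$ of $\dot x=\theta Ax+Bu$, $x(0)=0$). In discrete time, $T$ is a positive integer, $u=(u_0,\ldots,u_{T-1})$ is a sequence in $\mathbb{R}^m$ and $\varphi(T,\theta,u)=\sum_{k=0}^{T-1}(\theta A)^kBu_{T-1-k}$. The claim is asserted for each of the two notions. *)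

theory Defs
  imports "HOL-Analysis.Analysis"
begin

text \<open>
  The class operations \<open>*\<close> and \<open>^\<close> on \<open>real^'n^'n\<close> act componentwise, so \<open>^\<close> and \<open>exp\<close>
  cannot be used for the powers and the exponential of a matrix.
\<close>

primrec matpow :: "real^'n^'n \<Rightarrow> nat \<Rightarrow> real^'n^'n" where
  "matpow A 0 = mat 1"
| "matpow A (Suc k) = A ** matpow A k"

definition matexp :: "real^'n^'n \<Rightarrow> real^'n^'n" where
  "matexp A = (\<Sum>k. (1 / fact k) *\<^sub>R matpow A k)"

definition phi_cont :: "real^'n^'n \<Rightarrow> real^'m^'n \<Rightarrow> real \<Rightarrow> real \<Rightarrow> (real \<Rightarrow> real^'m) \<Rightarrow> real^'n" where
  "phi_cont A B T \<theta> u = integral {0..T} (\<lambda>s. matexp ((\<theta> * (T - s)) *\<^sub>R A) *v (B *v u s))"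

definition phi_disc :: "real^'n^'n \<Rightarrow> real^'m^'n \<Rightarrow> nat \<Rightarrow> real \<Rightarrow> (nat \<Rightarrow> real^'m) \<Rightarrow> real^'n" where
  "phi_disc A B T \<theta> u = (\<Sum>k<T. matpow (\<theta> *\<^sub>R A) k *v (B *v u (T - 1 - k)))"

text \<open>
  The suprema are taken in \<open>ereal\<close>, where they are meaningful without a boundedness proof.
  For \<open>{0..T}\<close> and vector-valued \<open>u\<close>, absolute integrability is membership in \<open>L\<^sup>1\<close>
  with respect to Lebesgue measure.  In discrete time only \<open>u 0, \<dots>, u (T - 1)\<close> matter.
\<close>

definition unif_ens_controllable_cont ::
    "real set \<Rightarrow> real^'n^'n \<Rightarrow> real^'m^'n \<Rightarrow> bool" where
  "unif_ens_controllable_cont P A B \<longleftrightarrow>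
     (\<forall>x :: real \<Rightarrow> real^'n. continuous_on P x \<longrightarrow>
       (\<forall>\<epsilon>>0. \<exists>T>0. \<exists>u :: real \<Rightarrow> real^'m.
          u absolutely_integrable_on {0..T} \<and>
          (SUP \<theta>\<in>P. ereal (norm (phi_cont A B T \<theta> u - x \<theta>))) < ereal \<epsilon>))"

definition unif_ens_controllable_disc ::
    "real set \<Rightarrow> real^'n^'n \<Rightarrow> real^'m^'n \<Rightarrow> bool" where
  "unif_ens_controllable_disc P A B \<longleftrightarrow>
     (\<forall>x :: real \<Rightarrow> real^'n. continuous_on P x \<longrightarrow>
       (\<forall>\<epsilon>>0. \<exists>T>0. \<exists>u :: nat \<Rightarrow> real^'m.
          (SUP \<theta>\<in>P. ereal (norm (phi_disc A B T \<theta> u - x \<theta>))) < ereal \<epsilon>))"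

end

theory Submission
  imports Defs
begin

text \<open>
  Necessity: at \<open>\<theta> = 0\<close> only the range of \<open>B\<close> can be reached, so the range is dense and hence
  everything; and if \<open>z v* A = 0\<close> then \<open>z \<bullet> \<phi>(T, \<theta>, u)\<close> does not depend on \<open>\<theta>\<close>, which excludes
  the target \<open>\<theta> \<mapsto> \<theta> *\<^sub>R z\<close> unless \<open>z = 0\<close>.

  Sufficiency: by Weierstrass it is enough to approximate the targets \<open>\<theta> \<mapsto> \<theta> ^ k *\<^sub>R w\<close>.  In discrete
  time these are reached exactly.  In continuous time the fixed horizon \<open>T = 1\<close> suffices.  The functions
  reached by inputs that are constant up to time \<open>r\<close> and zero afterwards form a family that is smooth in
  \<open>r\<close>.  The uniform closure of the reachable set is a closed linear space, so it also contains all
  \<open>r\<close>-derivatives of this family; at \<open>r = 1\<close> these are, up to sign, \<open>\<theta> ^ k *\<^sub>R (matpow A k *v (B *v y))\<close>.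
\<close>

section \<open>Exponential series with coefficients in a Euclidean space\<close>

definition expser :: "(nat \<Rightarrow> 'a::euclidean_space) \<Rightarrow> real \<Rightarrow> 'a" where
  "expser a t = (\<Sum>n. (t ^ n / fact n) *\<^sub>R a n)"

text \<open>A growth condition that makes \<open>expser a\<close> converge everywhere and survives
  both operations applied to coefficients: index shifts and bounded linear maps.\<close>

definition geom_bounded :: "(nat \<Rightarrow> 'a::euclidean_space) \<Rightarrow> bool" where
  "geom_bounded a \<longleftrightarrow> (\<exists>C K. \<forall>n. norm (a n) \<le> C * K ^ n)"

text \<open>Comparison with \<open>C\<close> times the scalar exponential series at
  \<open>K * \<bar>t\<bar>\<close>.\<close>

lemma summable_expser:
  assumes "geom_bounded a"
  shows "summable (\<lambda>n. (t ^ n / fact n) *\<^sub>R a n)"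
proof -
  obtain C K where CK: "\<And>n. norm (a n) \<le> C * K ^ n"
    using assms by (auto simp: geom_bounded_def)
  have "summable (\<lambda>n. C * ((K * \<bar>t\<bar>) ^ n / fact n))"
    using summable_exp[of "K * \<bar>t\<bar>"] by (intro summable_mult) (simp add: field_simps)
  then show ?thesis
  proof (rule summable_comparison_test'[where N = 0])
    fix n :: nat
    have "norm ((t ^ n / fact n) *\<^sub>R a n) = \<bar>t\<bar> ^ n / fact n * norm (a n)"
      by (simp add: power_abs)
    also have "\<dots> \<le> \<bar>t\<bar> ^ n / fact n * (C * K ^ n)"
      by (intro mult_left_mono CK) auto
    finally show "norm ((t ^ n / fact n) *\<^sub>R a n) \<le> C * ((K * \<bar>t\<bar>) ^ n / fact n)"
      by (simp add: power_mult_distrib field_simps)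
  qed
qed

text \<open>Reduces questions about the vector series to real series, with \<open>f\<close> a
  coordinate or a functional of a matrix.\<close>

lemma expser_bounded_linear:
  assumes "geom_bounded a" "bounded_linear f"
  shows "f (expser a t) = (\<Sum>n. (t ^ n / fact n) *\<^sub>R f (a n))"
proof -
  interpret bounded_linear f by fact
  show ?thesis
    unfolding expser_def suminf[OF summable_expser[OF assms(1)]] by (simp add: scale)
qed

lemma geom_bounded_shift:
  assumes "geom_bounded a"
  shows "geom_bounded (\<lambda>n. a (k + n))"
proof -
  obtain C K where CK: "\<And>n. norm (a n) \<le> C * K ^ n"
    using assms by (auto simp: geom_bounded_def)
  have "norm (a (k + n)) \<le> (C * K ^ k) * K ^ n" for n
    using CK[of "k + n"] by (simp add: power_add mult.assoc)
  then show ?thesis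
    unfolding geom_bounded_def by blast
qed

lemma geom_bounded_bounded_linear:
  assumes "geom_bounded a" "bounded_linear f"
  shows "geom_bounded (\<lambda>n. f (a n))"
proof -
  obtain C K where CK: "\<And>n. norm (a n) \<le> C * K ^ n"
    using assms by (auto simp: geom_bounded_def)
  obtain D where D: "D > 0" "\<And>x. norm (f x) \<le> norm x * D"
    using bounded_linear.pos_bounded[OF assms(2)] by blast
  have "norm (f (a n)) \<le> (C * D) * K ^ n" for n
    using order_trans[OF D(2) mult_right_mono[OF CK, of D n]] D(1) by (simp add: mult_ac)
  then show ?thesis
    unfolding geom_bounded_def by blast
qed

text \<open>Each coordinate is an everywhere convergent real power series, so it may be
  differentiated termwise.\<close>

lemma expser_has_vector_derivative:
  assumes "geom_bounded a"
  shows "(expser a has_vector_derivative expser (\<lambda>n. a (Suc n)) t) (at t)"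
proof -
  have shift: "geom_bounded (\<lambda>n. a (Suc n))"
    using geom_bounded_shift[OF assms, of 1] by simp
  have "((\<lambda>x. expser a x \<bullet> b) has_field_derivative expser (\<lambda>n. a (Suc n)) t \<bullet> b) (at t)" for b
  proof -
    define c where "c n = a n \<bullet> b / fact n" for n
    have bl: "bounded_linear (\<lambda>x::'a. x \<bullet> b)"
      by (rule bounded_linear_inner_left)
    have "summable (\<lambda>n. c n * y ^ n)" for y
      using summable_expser[OF geom_bounded_bounded_linear[OF assms bl], of y]
      by (simp add: c_def field_simps)
    then have "((\<lambda>x. \<Sum>n. c n * x ^ n) has_field_derivative (\<Sum>n. diffs c n * t ^ n)) (at t)"
      by (rule termdiffs_strong_converges_everywhere)
    \<comment> \<open>The factor \<open>Suc n\<close> produced by differentiation cancels against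
      \<open>fact (Suc n)\<close>, so only an index shift remains.\<close>
    moreover have "diffs c = (\<lambda>n. a (Suc n) \<bullet> b / fact n)"
      by (simp add: diffs_def c_def fun_eq_iff divide_simps del: of_nat_Suc)
    ultimately show ?thesis
      using expser_bounded_linear[OF assms bl] expser_bounded_linear[OF shift bl]
      by (simp add: c_def mult_ac)
  qed
  then show ?thesis
    unfolding has_vector_derivative_def has_derivative_componentwise_within[of "expser a"]
    by (auto simp: has_field_derivative_def mult.commute[of _ "expser _ _ \<bullet> _"])
qed

lemma expser_0: "expser a 0 = a 0"
proof -
  \<comment> \<open>Since \<open>0 ^ 0 = 1\<close>, the term at \<open>n = 0\<close>
    survives.\<close>
  have "(\<lambda>n. ((0::real) ^ n / fact n) *\<^sub>R a n) sums a 0"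
    using sums_finite[of "{0::nat}" "\<lambda>n. ((0::real) ^ n / fact n) *\<^sub>R a n"] by simp
  then show ?thesis
    by (simp add: expser_def sums_iff)
qed

lemma continuous_on_expser:
  assumes "geom_bounded a"
  shows "continuous_on S (expser a)"
  using expser_has_vector_derivative[OF assms]
  by (auto intro!: continuous_at_imp_continuous_on has_vector_derivative_continuous)

section \<open>Matrix powers, the matrix exponential and left null vectors\<close>

lemma bilinear_matrix_mult: "bilinear ((**) :: real^'n^'m \<Rightarrow> real^'p^'n \<Rightarrow> real^'p^'m)"
  unfolding bilinear_def
  by (auto intro!: linearI simp: vec_eq_iff matrix_matrix_mult_def sum.distrib sum_distrib_left
      algebra_simps)

lemma bilinear_matrix_vector_mult: "bilinear ((*v) :: real^'n^'m \<Rightarrow> real^'n \<Rightarrow> real^'m)"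
  unfolding bilinear_def
  by (auto intro!: linearI simp: algebra_simps scaleR_matrix_vector_assoc)

lemmas bounded_linear_matrix_vector_left =
  bounded_bilinear.bounded_linear_left[OF
    bilinear_matrix_vector_mult[unfolded bilinear_conv_bounded_bilinear]]

text \<open>Boundedness of the bilinear matrix product gives submultiplicativity of the norm up to a
  constant \<open>B\<close>, which is absorbed into the ratio \<open>B * norm A\<close>.\<close>

lemma geom_bounded_matpow:
  fixes A :: "real^'n^'n"
  shows "geom_bounded (matpow A)"
proof -
  obtain B where B: "B > 0" "\<And>(x::real^'n^'n) (y::real^'n^'n). norm (x ** y) \<le> B * norm x * norm y"
    using bilinear_bounded_pos[OF bilinear_matrix_mult] by blast
  have "norm (matpow A n) \<le> norm (mat 1 :: real^'n^'n) * (B * norm A) ^ n" for n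
  proof (induction n)
    case (Suc n)
    have "norm (matpow A (Suc n)) \<le> B * norm A * norm (matpow A n)"
      using B(2)[of A "matpow A n"] by simp
    also have "\<dots> \<le> B * norm A * (norm (mat 1 :: real^'n^'n) * (B * norm A) ^ n)"
      using B(1) Suc by (intro mult_left_mono) auto
    finally show ?case by (simp add: mult_ac)
  qed simp
  then show ?thesis
    unfolding geom_bounded_def by blast
qed

lemma matpow_scaleR: "matpow (c *\<^sub>R A) k = c ^ k *\<^sub>R matpow A k"
  by (induction k) (simp_all add: matrix_scalar_ac scalar_matrix_assoc[symmetric])

lemma matexp_scaleR: "matexp (t *\<^sub>R A) = expser (matpow A) t"
  by (simp add: matexp_def expser_def matpow_scaleR)

text \<open>Shifting the coefficients avoids commuting powers of \<open>A\<close> with the exponential.\<close>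

definition matexp_deriv :: "real^'n^'n \<Rightarrow> nat \<Rightarrow> real \<Rightarrow> real^'n^'n" where
  "matexp_deriv A k = expser (\<lambda>n. matpow A (k + n))"

lemma matexp_deriv_0: "matexp_deriv A 0 t = matexp (t *\<^sub>R A)"
  by (simp add: matexp_deriv_def matexp_scaleR)

lemma matexp_deriv_at_0: "matexp_deriv A k 0 = matpow A k"
  by (simp add: matexp_deriv_def expser_0)

lemma matexp_deriv_has_vector_derivative:
  "(matexp_deriv A k has_vector_derivative matexp_deriv A (Suc k) t) (at t)"
  using expser_has_vector_derivative[OF geom_bounded_shift[OF geom_bounded_matpow[of A], of k], of t]
  by (simp add: matexp_deriv_def)

lemma continuous_on_matexp_deriv: "continuous_on S (matexp_deriv A k)"
  unfolding matexp_deriv_def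
  by (intro continuous_on_expser geom_bounded_shift geom_bounded_matpow)

text \<open>Every power with positive exponent has \<open>A\<close> as its leftmost factor, which
  \<open>z\<close> annihilates; only the identity term of the series remains.\<close>

lemma inner_matexp_left_null:
  assumes "z v* A = 0"
  shows "z \<bullet> (matexp (t *\<^sub>R A) *v y) = z \<bullet> y"
proof -
  have bl: "bounded_linear (\<lambda>M. z \<bullet> (M *v y))"
    by (intro bounded_linear_compose[OF bounded_linear_inner_right]
        bounded_linear_matrix_vector_left)
  have "z \<bullet> (matpow A n *v y) = 0" if "n \<noteq> 0" for n
    using that assms
    by (cases n) (simp_all add: matrix_vector_mul_assoc[symmetric] dot_lmul_matrix[symmetric])
  then have "(\<lambda>n. (t ^ n / fact n) *\<^sub>R (z \<bullet> (matpow A n *v y))) sums (z \<bullet> y)"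
    using sums_finite[of "{0::nat}" "\<lambda>n. (t ^ n / fact n) *\<^sub>R (z \<bullet> (matpow A n *v y))"] by auto
  then show ?thesis
    using expser_bounded_linear[OF geom_bounded_matpow bl, of A t]
    by (simp add: matexp_scaleR sums_iff)
qed

lemma inner_matpow_left_null:
  assumes "z v* A = 0" "k \<noteq> 0"
  shows "z \<bullet> (matpow (\<theta> *\<^sub>R A) k *v y) = 0"
  using assms
  by (cases k) (simp_all add: matrix_vector_mul_assoc[symmetric] dot_lmul_matrix[symmetric]
      scaleR_matrix_vector_assoc[symmetric])

text \<open>The kernel is continuous, hence measurable and bounded on the compact interval, and its
  product with an integrable function is integrable. This justifies additivity in \<open>u\<close>
  and moving functionals under the integral.\<close>

lemma phi_cont_integrable:
  assumes "u absolutely_integrable_on {0..T}"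
  shows "(\<lambda>s. matexp ((\<theta> * (T - s)) *\<^sub>R A) *v (B *v u s)) integrable_on {0..T}"
proof -
  have cont: "continuous_on {0..T} (\<lambda>s. matexp ((\<theta> * (T - s)) *\<^sub>R A))"
    unfolding matexp_deriv_0[symmetric]
    by (intro continuous_on_compose2[OF continuous_on_matexp_deriv[of UNIV]] continuous_intros) auto
  have "(\<lambda>s. matexp ((\<theta> * (T - s)) *\<^sub>R A) *v (B *v u s)) absolutely_integrable_on {0..T}"
  proof (rule absolutely_integrable_bounded_measurable_product[OF bilinear_matrix_vector_mult])
    show "(\<lambda>s. matexp ((\<theta> * (T - s)) *\<^sub>R A)) \<in> borel_measurable (lebesgue_on {0..T})"
      using cont by (rule continuous_imp_measurable_on_sets_lebesgue) auto
    show "bounded ((\<lambda>s. matexp ((\<theta> * (T - s)) *\<^sub>R A)) ` {0..T})"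
      by (intro compact_imp_bounded compact_continuous_image cont) auto
    show "(\<lambda>s. B *v u s) absolutely_integrable_on {0..T}"
      using absolutely_integrable_linear[OF assms matrix_vector_mul_bounded_linear[of B]]
      by (simp add: o_def)
  qed auto
  then show ?thesis
    by (simp add: absolutely_integrable_on_def)
qed

section \<open>Polynomial targets and sufficiency in discrete time\<close>

lemma vector_Weierstrass:
  fixes x :: "real \<Rightarrow> 'a::euclidean_space"
  assumes "compact P" "continuous_on P x" "\<epsilon> > 0"
  obtains N and w :: "nat \<Rightarrow> 'a" where "\<And>\<theta>. \<theta> \<in> P \<Longrightarrow> norm ((\<Sum>k\<le>N. \<theta> ^ k *\<^sub>R w k) - x \<theta>) < \<epsilon>"
proof -
  obtain g where g: "polynomial_function g" "\<And>\<theta>. \<theta> \<in> P \<Longrightarrow> norm (x \<theta> - g \<theta>) < \<epsilon>"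
    using Stone_Weierstrass_polynomial_function[OF assms] by blast
  have "\<exists>a n. (\<lambda>\<theta>. g \<theta> \<bullet> b) = (\<lambda>\<theta>. \<Sum>k\<le>n. a k * \<theta> ^ k)" if "b \<in> Basis" for b
    using g(1) that polynomial_function_iff_Basis_inner real_polynomial_function_iff_sum
    by blast
  then obtain a n where an:
    "\<And>b \<theta>. b \<in> Basis \<Longrightarrow> g \<theta> \<bullet> b = (\<Sum>k\<le>n b. a b k * \<theta> ^ k)"
    unfolding fun_eq_iff by metis
  \<comment> \<open>The coordinate polynomials have different degrees; padding with zero
    coefficients up to the largest one lets them be collected into vector coefficients.\<close>
  define N where "N = Max (n ` Basis)"
  define a' where "a' b k = (if k \<le> n b then a b k else 0)" for b k
  define w where "w k = (\<Sum>b\<in>Basis. a' b k *\<^sub>R b)" for k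
  have "g \<theta> = (\<Sum>k\<le>N. \<theta> ^ k *\<^sub>R w k)" for \<theta>
  proof -
    have "g \<theta> \<bullet> b = (\<Sum>k\<le>N. a' b k * \<theta> ^ k)" if "b \<in> Basis" for b
    proof -
      have "n b \<le> N" using that by (simp add: N_def)
      then show ?thesis
        unfolding an[OF that] a'_def
        by (intro sum.mono_neutral_cong_left) auto
    qed
    then have "g \<theta> = (\<Sum>b\<in>Basis. (\<Sum>k\<le>N. a' b k * \<theta> ^ k) *\<^sub>R b)"
      using euclidean_representation[of "g \<theta>"] by simp
    also have "\<dots> = (\<Sum>k\<le>N. \<theta> ^ k *\<^sub>R w k)"
      unfolding w_def scaleR_sum_right scaleR_sum_left by (subst sum.swap) (simp add: mult.commute)
    finally show ?thesis .
  qed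
  then show ?thesis
    using g(2) by (intro that[of w N]) (metis norm_minus_commute)
qed

lemma matpow_surj:
  assumes "surj ((*v) A)"
  shows "surj ((*v) (matpow A k))"
proof (induction k)
  case (Suc k)
  have "(*v) (matpow A (Suc k)) = (*v) A \<circ> (*v) (matpow A k)"
    by (simp add: fun_eq_iff matrix_vector_mul_assoc)
  then show ?case
    using comp_surj[OF Suc assms] by simp
qed simp

lemma matpow_preimage:
  assumes "surj ((*v) A)" "surj ((*v) B)"
  obtains y where "matpow A k *v (B *v y) = w"
  using matpow_surj[OF assms(1), of k] assms(2) that by (metis surjD)

text \<open>Strict pointwise bounds give only a weak bound on the supremum, hence the margin
  \<open>\<epsilon> / 2\<close>.\<close>

lemma SUP_ereal_norm_less:
  assumes "\<And>\<theta>. \<theta> \<in> P \<Longrightarrow> norm (f \<theta>) < \<epsilon> / 2" "\<epsilon> > 0"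
  shows "(SUP \<theta>\<in>P. ereal (norm (f \<theta>))) < ereal \<epsilon>"
proof -
  have "(SUP \<theta>\<in>P. ereal (norm (f \<theta>))) \<le> ereal (\<epsilon> / 2)"
    using assms(1) by (intro SUP_least) (simp add: less_imp_le)
  also have "\<dots> < ereal \<epsilon>" using assms(2) by simp
  finally show ?thesis .
qed

lemma norm_less_of_SUP_ereal_less:
  assumes "(SUP \<theta>\<in>P. ereal (norm (f \<theta>))) < ereal \<epsilon>" "\<theta> \<in> P"
  shows "norm (f \<theta>) < \<epsilon>"
  using le_less_trans[OF SUP_upper[OF assms(2)] assms(1)] by simp

lemma unif_ens_controllable_disc_if_surj:
  fixes A :: "real^'n^'n" and B :: "real^'m^'n"
  assumes "compact P" "surj ((*v) A)" "surj ((*v) B)"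
  shows "unif_ens_controllable_disc P A B"
  unfolding unif_ens_controllable_disc_def
proof (intro allI impI)
  fix x :: "real \<Rightarrow> real^'n" and \<epsilon> :: real
  assume "continuous_on P x" "\<epsilon> > 0"
  then obtain N w where Nw: "\<And>\<theta>. \<theta> \<in> P \<Longrightarrow> norm ((\<Sum>k\<le>N. \<theta> ^ k *\<^sub>R w k) - x \<theta>) < \<epsilon> / 2"
    using vector_Weierstrass[OF assms(1), of x "\<epsilon> / 2"] half_gt_zero by blast
  have "\<exists>y. matpow A k *v (B *v y) = w k" for k
    using matpow_preimage[OF assms(2,3), of k "w k"] by blast
  then obtain y where y: "\<And>k. matpow A k *v (B *v y k) = w k"
    by metis
  \<comment> \<open>The power \<open>k\<close> meets the input at time \<open>T - 1 - k\<close>,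
    here \<open>N - k\<close>; listing the \<open>y k\<close> in reverse order pairs each with its
    own power.\<close>
  have "phi_disc A B (Suc N) \<theta> (\<lambda>k. y (N - k)) = (\<Sum>k\<le>N. \<theta> ^ k *\<^sub>R w k)" for \<theta>
    unfolding phi_disc_def
  proof (rule sum.cong)
    fix k assume "k \<in> {..N}"
    then have "N - (Suc N - 1 - k) = k" by simp
    then show "matpow (\<theta> *\<^sub>R A) k *v (B *v y (N - (Suc N - 1 - k))) = \<theta> ^ k *\<^sub>R w k"
      by (simp only: matpow_scaleR scaleR_matrix_vector_assoc[symmetric] y)
  qed (rule lessThan_Suc_atMost)
  then have "(SUP \<theta>\<in>P. ereal (norm (phi_disc A B (Suc N) \<theta> (\<lambda>k. y (N - k)) - x \<theta>))) < ereal \<epsilon>"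
    using Nw \<open>\<epsilon> > 0\<close> by (intro SUP_ereal_norm_less) simp_all
  then show "\<exists>T>0. \<exists>u. (SUP \<theta>\<in>P. ereal (norm (phi_disc A B T \<theta> u - x \<theta>))) < ereal \<epsilon>"
    by blast
qed

section \<open>Uniform closures of linear families of functions\<close>

definition uniform_closure :: "'a set \<Rightarrow> ('a \<Rightarrow> 'b::real_normed_vector) set \<Rightarrow> ('a \<Rightarrow> 'b) set" where
  "uniform_closure P R = {x. \<forall>\<epsilon>>0. \<exists>f\<in>R. \<forall>\<theta>\<in>P. norm (f \<theta> - x \<theta>) < \<epsilon>}"

lemma uniform_closure_subset: "R \<subseteq> uniform_closure P R"
  by (force simp: uniform_closure_def)

text \<open>Taking the closure twice adds nothing, by the triangle inequality with two halves of
  \<open>\<epsilon>\<close>. This serves both for limits of difference quotients and for the final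
  polynomial approximation.\<close>

lemma uniform_closure_closed:
  assumes "\<And>\<epsilon>. \<epsilon> > 0 \<Longrightarrow> \<exists>f\<in>uniform_closure P R. \<forall>\<theta>\<in>P. norm (f \<theta> - x \<theta>) < \<epsilon>"
  shows "x \<in> uniform_closure P R"
  unfolding uniform_closure_def
proof (intro CollectI allI impI)
  fix \<epsilon> :: real assume "\<epsilon> > 0"
  then obtain f where f: "f \<in> uniform_closure P R" "\<And>\<theta>. \<theta> \<in> P \<Longrightarrow> norm (f \<theta> - x \<theta>) < \<epsilon> / 2"
    using assms[of "\<epsilon> / 2"] by auto
  then obtain g where g: "g \<in> R" "\<And>\<theta>. \<theta> \<in> P \<Longrightarrow> norm (g \<theta> - f \<theta>) < \<epsilon> / 2"
    using \<open>\<epsilon> > 0\<close> unfolding uniform_closure_def by (auto dest!: spec[of _ "\<epsilon> / 2"])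
  have "norm (g \<theta> - x \<theta>) < \<epsilon>" if "\<theta> \<in> P" for \<theta>
    using norm_triangle_lt[of "g \<theta> - f \<theta>" "f \<theta> - x \<theta>" \<epsilon>] f(2)[OF that] g(2)[OF that] by simp
  with g(1) show "\<exists>f\<in>R. \<forall>\<theta>\<in>P. norm (f \<theta> - x \<theta>) < \<epsilon>" by blast
qed

definition linear_family :: "('a \<Rightarrow> 'b::real_vector) set \<Rightarrow> bool" where
  "linear_family R \<longleftrightarrow> (\<lambda>_. 0) \<in> R \<and>
     (\<forall>f\<in>R. \<forall>g\<in>R. (\<lambda>\<theta>. f \<theta> + g \<theta>) \<in> R) \<and> (\<forall>c. \<forall>f\<in>R. (\<lambda>\<theta>. c *\<^sub>R f \<theta>) \<in> R)"

lemma linear_family_uniform_closure: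
  assumes "linear_family R"
  shows "linear_family (uniform_closure P R)"
  unfolding linear_family_def
proof (intro conjI ballI allI)
  show "(\<lambda>_. 0) \<in> uniform_closure P R"
    using assms uniform_closure_subset[of R P] by (auto simp: linear_family_def)
next
  fix f g assume fg: "f \<in> uniform_closure P R" "g \<in> uniform_closure P R"
  show "(\<lambda>\<theta>. f \<theta> + g \<theta>) \<in> uniform_closure P R"
    unfolding uniform_closure_def
  proof (intro CollectI allI impI)
    fix \<epsilon> :: real assume "\<epsilon> > 0"
    then obtain f' g' where f': "f' \<in> R" "\<And>\<theta>. \<theta> \<in> P \<Longrightarrow> norm (f' \<theta> - f \<theta>) < \<epsilon> / 2"
      and g': "g' \<in> R" "\<And>\<theta>. \<theta> \<in> P \<Longrightarrow> norm (g' \<theta> - g \<theta>) < \<epsilon> / 2"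
      using fg unfolding uniform_closure_def
      by (auto dest!: spec[of _ "\<epsilon> / 2"])
    have "norm ((f' \<theta> + g' \<theta>) - (f \<theta> + g \<theta>)) < \<epsilon>" if "\<theta> \<in> P" for \<theta>
      using norm_diff_triangle_ineq[of "f' \<theta>" "g' \<theta>" "f \<theta>" "g \<theta>"] f'(2)[OF that] g'(2)[OF that]
      by simp
    moreover have "(\<lambda>\<theta>. f' \<theta> + g' \<theta>) \<in> R"
      using assms f'(1) g'(1) by (simp add: linear_family_def)
    ultimately show "\<exists>h\<in>R. \<forall>\<theta>\<in>P. norm (h \<theta> - (f \<theta> + g \<theta>)) < \<epsilon>"
      by (intro bexI[of _ "\<lambda>\<theta>. f' \<theta> + g' \<theta>"]) auto
  qed
next
  fix c f assume f: "f \<in> uniform_closure P R"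
  show "(\<lambda>\<theta>. c *\<^sub>R f \<theta>) \<in> uniform_closure P R"
    unfolding uniform_closure_def
  proof (intro CollectI allI impI)
    fix \<epsilon> :: real assume "\<epsilon> > 0"
    \<comment> \<open>Dividing by \<open>\<bar>c\<bar> + 1\<close> also covers
      \<open>c = 0\<close>.\<close>
    then obtain f' where f': "f' \<in> R" "\<And>\<theta>. \<theta> \<in> P \<Longrightarrow> norm (f' \<theta> - f \<theta>) < \<epsilon> / (\<bar>c\<bar> + 1)"
      using f unfolding uniform_closure_def
      by (auto dest!: spec[of _ "\<epsilon> / (\<bar>c\<bar> + 1)"])
    have "norm (c *\<^sub>R f' \<theta> - c *\<^sub>R f \<theta>) < \<epsilon>" if "\<theta> \<in> P" for \<theta>
    proof -
      have "norm (c *\<^sub>R f' \<theta> - c *\<^sub>R f \<theta>) = \<bar>c\<bar> * norm (f' \<theta> - f \<theta>)"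
        by (simp flip: scaleR_diff_right)
      also have "\<dots> \<le> (\<bar>c\<bar> + 1) * norm (f' \<theta> - f \<theta>)"
        by (intro mult_right_mono) auto
      also have "\<dots> < (\<bar>c\<bar> + 1) * (\<epsilon> / (\<bar>c\<bar> + 1))"
        by (intro mult_strict_left_mono f'(2) that) auto
      also have "\<dots> = \<epsilon>" by (simp add: add_nonneg_eq_0_iff)
      finally show ?thesis .
    qed
    moreover have "(\<lambda>\<theta>. c *\<^sub>R f' \<theta>) \<in> R"
      using assms f'(1) by (simp add: linear_family_def)
    ultimately show "\<exists>h\<in>R. \<forall>\<theta>\<in>P. norm (h \<theta> - c *\<^sub>R f \<theta>) < \<epsilon>"
      by (intro bexI[of _ "\<lambda>\<theta>. c *\<^sub>R f' \<theta>"]) auto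
  qed
qed

lemma linear_family_add:
  "linear_family R \<Longrightarrow> f \<in> R \<Longrightarrow> g \<in> R \<Longrightarrow> (\<lambda>\<theta>. f \<theta> + g \<theta>) \<in> R"
  by (simp add: linear_family_def)

lemma linear_family_scaleR: "linear_family R \<Longrightarrow> f \<in> R \<Longrightarrow> (\<lambda>\<theta>. c *\<^sub>R f \<theta>) \<in> R"
  by (simp add: linear_family_def)

lemma linear_family_sum:
  assumes "linear_family R" "finite I" "\<And>i. i \<in> I \<Longrightarrow> f i \<in> R"
  shows "(\<lambda>\<theta>. \<Sum>i\<in>I. f i \<theta>) \<in> R"
  using assms(2,3)
  by (induction I rule: finite_induct)
    (use assms(1) in \<open>auto simp: linear_family_def\<close>)

lemma linear_family_diff:
  assumes "linear_family R" "f \<in> R" "g \<in> R"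
  shows "(\<lambda>\<theta>. f \<theta> - g \<theta>) \<in> R"
  using linear_family_add[OF assms(1,2) linear_family_scaleR[OF assms(1,3), of "-1"]] by simp

text \<open>Joint continuity of the derivative makes the difference quotients converge uniformly
  in \<open>\<theta>\<close>.\<close>

lemma uniform_closure_derivative:
  fixes f f' :: "real \<Rightarrow> real \<Rightarrow> 'b::real_normed_vector"
  assumes "linear_family R" "compact P"
    and f: "\<And>r. r \<in> {0..1} \<Longrightarrow> f r \<in> uniform_closure P R"
    and deriv: "\<And>r \<theta>. r \<in> {0..1} \<Longrightarrow> \<theta> \<in> P \<Longrightarrow>
      ((\<lambda>r. f r \<theta>) has_vector_derivative f' r \<theta>) (at r within {0..1})"
    and cont: "continuous_on ({0..1} \<times> P) (\<lambda>(r, \<theta>). f' r \<theta>)"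
    and r: "r \<in> {0..1}"
  shows "f' r \<in> uniform_closure P R"
proof (rule uniform_closure_closed)
  fix \<epsilon> :: real assume "\<epsilon> > 0"
  have "uniformly_continuous_on ({0..1} \<times> P) (\<lambda>(r, \<theta>). f' r \<theta>)"
    using cont assms(2) by (intro compact_uniformly_continuous compact_Times) auto
  then obtain d where "d > 0" and d: "\<And>s \<theta>. s \<in> {0..1} \<Longrightarrow> \<theta> \<in> P \<Longrightarrow> \<bar>s - r\<bar> < d \<Longrightarrow>
      norm (f' s \<theta> - f' r \<theta>) < \<epsilon> / 2"
    using r \<open>\<epsilon> > 0\<close> unfolding uniformly_continuous_on_def
    by (auto dest!: spec[of _ "\<epsilon> / 2"] simp: dist_norm dist_Pair_Pair)
  \<comment> \<open>A second point for the difference quotient: to the left of \<open>r\<close> at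
    the right endpoint, to the right otherwise, clamped to the unit interval.\<close>
  obtain s where s: "s \<in> {0..1}" "s \<noteq> r" "\<bar>s - r\<bar> < d"
  proof (cases "r = 1")
    case True
    then show ?thesis using \<open>d > 0\<close> by (intro that[of "max 0 (1 - d / 2)"]) auto
  next
    case False
    then show ?thesis using \<open>d > 0\<close> r by (intro that[of "min 1 (r + d / 2)"]) auto
  qed
  have "norm ((1 / (s - r)) *\<^sub>R (f s \<theta> - f r \<theta>) - f' r \<theta>) < \<epsilon>" if "\<theta> \<in> P" for \<theta>
  proof -
    let ?S = "closed_segment r s"
    have S: "?S \<subseteq> {0..1}"
      using r s(1) by (intro closed_segment_subset) auto
    \<comment> \<open>Mean value inequality for the linearization at \<open>r\<close>: along the
      segment the derivative varies by at most \<open>\<epsilon> / 2\<close>, and \<open>d\<close>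
      was chosen independently of \<open>\<theta>\<close>.\<close>
    have "norm (f s \<theta> - f r \<theta> - (s - r) *\<^sub>R f' r \<theta>) \<le> norm (s - r) * (\<epsilon> / 2)"
    proof (rule vector_differentiable_bound_linearization[where S = ?S and ?x0.0 = r and
          f = "\<lambda>r. f r \<theta>" and f' = "\<lambda>r. f' r \<theta>"])
      fix t assume t: "t \<in> ?S"
      show "((\<lambda>r. f r \<theta>) has_vector_derivative f' t \<theta>) (at t within ?S)"
        using deriv S t that by (blast intro: has_vector_derivative_within_subset)
      have "\<bar>t - r\<bar> \<le> \<bar>s - r\<bar>"
        using t by (auto simp: closed_segment_eq_real_ivl split: if_splits)
      then show "norm (f' t \<theta> - f' r \<theta>) \<le> \<epsilon> / 2"
        using d[of t \<theta>] S t that s(3) by force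
    qed auto
    moreover have "f s \<theta> - f r \<theta> - (s - r) *\<^sub>R f' r \<theta> =
        (s - r) *\<^sub>R ((1 / (s - r)) *\<^sub>R (f s \<theta> - f r \<theta>) - f' r \<theta>)"
      using s(2) by (simp add: scaleR_diff_right)
    ultimately have "norm ((1 / (s - r)) *\<^sub>R (f s \<theta> - f r \<theta>) - f' r \<theta>) \<le> \<epsilon> / 2"
      using s(2) by simp
    then show ?thesis using \<open>\<epsilon> > 0\<close> by simp
  qed
  moreover have "(\<lambda>\<theta>. (1 / (s - r)) *\<^sub>R (f s \<theta> - f r \<theta>)) \<in> uniform_closure P R"
    using linear_family_uniform_closure[OF assms(1), of P] f r s(1)
    by (intro linear_family_scaleR linear_family_diff) auto
  ultimately show "\<exists>g\<in>uniform_closure P R. \<forall>\<theta>\<in>P. norm (g \<theta> - f' r \<theta>) < \<epsilon>"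
    by (intro bexI[of _ "\<lambda>\<theta>. (1 / (s - r)) *\<^sub>R (f s \<theta> - f r \<theta>)"] ballI)
qed

section \<open>Reachable functions with horizon 1 and sufficiency in continuous time\<close>

definition reachable_1 :: "real^'n^'n \<Rightarrow> real^'m^'n \<Rightarrow> (real \<Rightarrow> real^'n) set" where
  "reachable_1 A B = {\<lambda>\<theta>. phi_cont A B 1 \<theta> u | u. u absolutely_integrable_on {0..1}}"

text \<open>With one common horizon, inputs can be added and scaled pointwise, and
  \<open>phi_cont\<close> is linear in the input.\<close>

lemma linear_family_reachable_1: "linear_family (reachable_1 A B)"
  unfolding linear_family_def
proof (intro conjI ballI allI)
  have "phi_cont A B 1 \<theta> (\<lambda>_. 0) = 0" for \<theta>
    by (simp add: phi_cont_def)
  then show "(\<lambda>_. 0) \<in> reachable_1 A B"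
    unfolding reachable_1_def by (intro CollectI exI[of _ "\<lambda>_. 0"]) (simp add: fun_eq_iff)
next
  fix f g assume "f \<in> reachable_1 A B" "g \<in> reachable_1 A B"
  then obtain u v where u: "u absolutely_integrable_on {0..1}" "f = (\<lambda>\<theta>. phi_cont A B 1 \<theta> u)"
    and v: "v absolutely_integrable_on {0..1}" "g = (\<lambda>\<theta>. phi_cont A B 1 \<theta> v)"
    by (auto simp: reachable_1_def)
  have "phi_cont A B 1 \<theta> (\<lambda>s. u s + v s) = f \<theta> + g \<theta>" for \<theta>
    using integral_add[OF phi_cont_integrable[OF u(1), of \<theta> A B]
        phi_cont_integrable[OF v(1), of \<theta> A B]]
    by (simp add: phi_cont_def u(2) v(2) matrix_vector_right_distrib)
  then show "(\<lambda>\<theta>. f \<theta> + g \<theta>) \<in> reachable_1 A B"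
    unfolding reachable_1_def
    using set_integral_add(1)[OF u(1) v(1)]
    by (intro CollectI exI[of _ "\<lambda>s. u s + v s"]) (simp add: fun_eq_iff)
next
  fix c f assume "f \<in> reachable_1 A B"
  then obtain u where u: "u absolutely_integrable_on {0..1}" "f = (\<lambda>\<theta>. phi_cont A B 1 \<theta> u)"
    by (auto simp: reachable_1_def)
  have "phi_cont A B 1 \<theta> (\<lambda>s. c *\<^sub>R u s) = c *\<^sub>R f \<theta>" for \<theta>
    by (simp add: phi_cont_def u(2) matrix_vector_mult_scaleR)
  then show "(\<lambda>\<theta>. c *\<^sub>R f \<theta>) \<in> reachable_1 A B"
    unfolding reachable_1_def
    using absolutely_integrable_scaleR_left[OF u(1), of c]
    by (intro CollectI exI[of _ "\<lambda>s. c *\<^sub>R u s"]) (simp add: fun_eq_iff)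
qed

text \<open>Provides the joint continuity required for differentiation inside the closure; the
  factor \<open>c\<close> accommodates the sign in the induction step below.\<close>

lemma continuous_on_matexp_deriv_joint:
  "continuous_on S (\<lambda>(r, \<theta>). c *\<^sub>R (\<theta> ^ k *\<^sub>R (matexp_deriv A j (\<theta> * (1 - r)) *v y)))"
  unfolding case_prod_beta
  by (intro continuous_intros bounded_linear.continuous_on[OF bounded_linear_matrix_vector_left]
      continuous_on_compose2[OF continuous_on_matexp_deriv[of UNIV]]) auto

text \<open>The input that equals \<open>y\<close> up to time \<open>r\<close> and vanishes afterwards.\<close>

lemma integral_matexp_in_reachable_1:
  assumes "r \<in> {0..1}"
  shows "(\<lambda>\<theta>. integral {0..r} (\<lambda>s. matexp_deriv A 0 (\<theta> * (1 - s)) *v (B *v y))) \<in> reachable_1 A B"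
proof -
  define u where "u s = (if s \<in> {0..r} then y else 0)" for s
  have "u absolutely_integrable_on {0..1}"
  proof -
    have "(\<lambda>s. y) absolutely_integrable_on {0..r}"
      by (intro absolutely_integrable_continuous_real continuous_intros)
    then have "u absolutely_integrable_on UNIV"
      unfolding u_def by (subst absolutely_integrable_restrict_UNIV)
    then show ?thesis
      by (rule set_integrable_subset) auto
  qed
  moreover have "phi_cont A B 1 \<theta> u =
      integral {0..r} (\<lambda>s. matexp_deriv A 0 (\<theta> * (1 - s)) *v (B *v y))" for \<theta>
  proof -
    have "phi_cont A B 1 \<theta> u = integral {0..1} (\<lambda>s. if s \<in> {0..r}
        then matexp_deriv A 0 (\<theta> * (1 - s)) *v (B *v y) else 0)"
      unfolding phi_cont_def u_def matexp_deriv_0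
      by (intro integral_cong) auto
    also have "\<dots> = integral {0..r} (\<lambda>s. matexp_deriv A 0 (\<theta> * (1 - s)) *v (B *v y))"
      using assms by (subst Henstock_Kurzweil_Integration.integral_restrict_Int)
        (simp add: Int_absorb2)
    finally show ?thesis .
  qed
  ultimately show ?thesis
    unfolding reachable_1_def by (intro CollectI exI[of _ u]) (simp add: fun_eq_iff)
qed

text \<open>Induction on the number of derivatives in \<open>r\<close>. The first derivative removes
  the integral; each later one contributes a factor \<open>- \<theta>\<close> and raises the index
  of \<open>matexp_deriv\<close>.\<close>

lemma matexp_deriv_in_closure:
  assumes "compact P" "r \<in> {0..1}"
  shows "(\<lambda>\<theta>. \<theta> ^ k *\<^sub>R (matexp_deriv A k (\<theta> * (1 - r)) *v (B *v y)))
    \<in> uniform_closure P (reachable_1 A B)"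
  using assms(2)
\<comment> \<open>The parameter \<open>r\<close> is generalized because a derivative at
  \<open>r\<close> is a limit of quotients involving other parameter values.\<close>
proof (induction k arbitrary: r)
  case 0
  have cont: "continuous_on {0..1} (\<lambda>s. matexp_deriv A 0 (\<theta> * (1 - s)) *v (B *v y))" for \<theta>
    by (intro continuous_intros bounded_linear.continuous_on[OF bounded_linear_matrix_vector_left]
        continuous_on_compose2[OF continuous_on_matexp_deriv[of UNIV]]) auto
  have "(\<lambda>\<theta>. matexp_deriv A 0 (\<theta> * (1 - r)) *v (B *v y)) \<in> uniform_closure P (reachable_1 A B)"
  proof (rule uniform_closure_derivative[OF linear_family_reachable_1 assms(1) _ _ _ 0,
        where f = "\<lambda>r \<theta>. integral {0..r} (\<lambda>s. matexp_deriv A 0 (\<theta> * (1 - s)) *v (B *v y))"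
          and f' = "\<lambda>r \<theta>. matexp_deriv A 0 (\<theta> * (1 - r)) *v (B *v y)"])
    show "(\<lambda>\<theta>. integral {0..r} (\<lambda>s. matexp_deriv A 0 (\<theta> * (1 - s)) *v (B *v y)))
        \<in> uniform_closure P (reachable_1 A B)" if "r \<in> {0..1}" for r
      using integral_matexp_in_reachable_1[OF that] uniform_closure_subset by blast
    show "continuous_on ({0..1} \<times> P) (\<lambda>(r, \<theta>). matexp_deriv A 0 (\<theta> * (1 - r)) *v (B *v y))"
      using continuous_on_matexp_deriv_joint[of _ 1 0] by simp
  qed (rule integral_has_vector_derivative[OF cont])
  then show ?case by simp
next
  case (Suc k)
  let ?f = "\<lambda>r \<theta>. \<theta> ^ k *\<^sub>R (matexp_deriv A k (\<theta> * (1 - r)) *v (B *v y))"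
  let ?f' = "\<lambda>r \<theta>. (-1) *\<^sub>R (\<theta> ^ Suc k *\<^sub>R (matexp_deriv A (Suc k) (\<theta> * (1 - r)) *v (B *v y)))"
  have "?f' r \<in> uniform_closure P (reachable_1 A B)"
  proof (rule uniform_closure_derivative[OF linear_family_reachable_1 assms(1),
        where f = ?f and f' = ?f'])
    fix r \<theta> :: real
    have "((\<lambda>r. \<theta> * (1 - r)) has_vector_derivative (- \<theta>)) (at r within {0..1})"
      by (auto intro!: derivative_eq_intros)
    from vector_diff_chain_within[OF this
        has_vector_derivative_at_within[OF matexp_deriv_has_vector_derivative]]
    have "((\<lambda>r. matexp_deriv A k (\<theta> * (1 - r))) has_vector_derivative
        (- \<theta>) *\<^sub>R matexp_deriv A (Suc k) (\<theta> * (1 - r))) (at r within {0..1})"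
      by (simp add: o_def)
    from bounded_linear.has_vector_derivative[OF bounded_linear_compose[OF
          bounded_linear_scaleR_right[of "\<theta> ^ k"] bounded_linear_matrix_vector_left[of "B *v y"]] this]
    show "((\<lambda>r. ?f r \<theta>) has_vector_derivative ?f' r \<theta>) (at r within {0..1})"
      by (simp add: scaleR_matrix_vector_assoc[symmetric] mult.commute del: scaleR_minus_left)
  qed (rule Suc.IH continuous_on_matexp_deriv_joint Suc.prems; assumption?)+
  \<comment> \<open>Scaling by \<open>-1\<close> removes the sign coming from the inner derivative
    of \<open>\<theta> * (1 - r)\<close>.\<close>
  from linear_family_scaleR[OF linear_family_uniform_closure[OF linear_family_reachable_1] this, of "-1"]
  show ?case by simp
qed

lemma unif_ens_controllable_cont_if_surj:
  fixes A :: "real^'n^'n" and B :: "real^'m^'n"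
  assumes "compact P" "surj ((*v) A)" "surj ((*v) B)"
  shows "unif_ens_controllable_cont P A B"
  unfolding unif_ens_controllable_cont_def
proof (intro allI impI)
  fix x :: "real \<Rightarrow> real^'n" and \<epsilon> :: real
  assume x: "continuous_on P x" and "\<epsilon> > 0"
  let ?V = "uniform_closure P (reachable_1 A B)"
  have monom: "(\<lambda>\<theta>. \<theta> ^ k *\<^sub>R w) \<in> ?V" for k w
  proof -
    obtain y where "matpow A k *v (B *v y) = w"
      using matpow_preimage[OF assms(2,3)] .
    then show ?thesis
      \<comment> \<open>At \<open>r = 1\<close> the argument of \<open>matexp_deriv\<close> is 0,
        which leaves the bare matrix power.\<close>
      using matexp_deriv_in_closure[OF assms(1), of 1 k A B y] by (simp add: matexp_deriv_at_0)
  qed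
  have "x \<in> ?V"
  proof (rule uniform_closure_closed)
    fix e :: real assume "e > 0"
    then obtain N w where "\<And>\<theta>. \<theta> \<in> P \<Longrightarrow> norm ((\<Sum>k\<le>N. \<theta> ^ k *\<^sub>R w k) - x \<theta>) < e"
      using vector_Weierstrass[OF assms(1) x] by blast
    moreover have "(\<lambda>\<theta>. \<Sum>k\<le>N. \<theta> ^ k *\<^sub>R w k) \<in> ?V"
      by (intro linear_family_sum linear_family_uniform_closure linear_family_reachable_1 monom) auto
    ultimately show "\<exists>f\<in>?V. \<forall>\<theta>\<in>P. norm (f \<theta> - x \<theta>) < e"
      by (intro bexI[of _ "\<lambda>\<theta>. \<Sum>k\<le>N. \<theta> ^ k *\<^sub>R w k"]) auto
  qed
  then obtain f where f: "f \<in> reachable_1 A B" "\<And>\<theta>. \<theta> \<in> P \<Longrightarrow> norm (f \<theta> - x \<theta>) < \<epsilon> / 2"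
    using \<open>\<epsilon> > 0\<close> unfolding uniform_closure_def by (auto dest!: spec[of _ "\<epsilon> / 2"])
  from f(1) obtain u where u: "u absolutely_integrable_on {0..1}" "f = (\<lambda>\<theta>. phi_cont A B 1 \<theta> u)"
    by (auto simp: reachable_1_def)
  have "(SUP \<theta>\<in>P. ereal (norm (phi_cont A B 1 \<theta> u - x \<theta>))) < ereal \<epsilon>"
    using f(2) \<open>\<epsilon> > 0\<close> u(2) by (intro SUP_ereal_norm_less) simp_all
  with u(1) show "\<exists>T>0. \<exists>u. u absolutely_integrable_on {0..T} \<and>
      (SUP \<theta>\<in>P. ereal (norm (phi_cont A B T \<theta> u - x \<theta>))) < ereal \<epsilon>"
    by (intro exI[of _ 1]) auto
qed

section \<open>Necessity of the rank conditions\<close>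

text \<open>Here \<open>R\<close> stands for the reachable functions of either time model. Constant
  targets evaluated at 0 test \<open>B\<close>; the target \<open>\<theta> *\<^sub>R z\<close> for a
  left null vector \<open>z\<close> tests \<open>A\<close>.\<close>

lemma full_rank_if_dense:
  fixes P :: "real set" and A :: "real^'n^'n" and B :: "real^'m^'n"
  assumes dense: "\<And>x \<epsilon>. continuous_on P x \<Longrightarrow> \<epsilon> > 0 \<Longrightarrow> \<exists>f\<in>R. \<forall>\<theta>\<in>P. norm (f \<theta> - x \<theta>) < \<epsilon>"
    and range: "\<And>f. f \<in> R \<Longrightarrow> f 0 \<in> range ((*v) B)"
    and null: "\<And>f z \<theta>. f \<in> R \<Longrightarrow> z v* A = 0 \<Longrightarrow> z \<bullet> f \<theta> = z \<bullet> f 0"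
    and P: "0 \<in> P" "\<theta>\<^sub>1 \<in> P" "\<theta>\<^sub>1 \<noteq> 0"
  shows "rank A = CARD('n)" "rank B = CARD('n)"
proof -
  show "rank B = CARD('n)"
    unfolding full_rank_surjective
  proof -
    have "y \<in> closure (range ((*v) B))" for y
      unfolding closure_approachable
    proof (intro allI impI)
      fix e :: real assume "e > 0"
      then obtain f where "f \<in> R" "norm (f 0 - y) < e"
        using dense[of "\<lambda>_. y" e] P(1) by auto
      then show "\<exists>v\<in>range ((*v) B). dist v y < e"
        by (intro bexI[of _ "f 0"] range) (simp_all add: dist_norm)
    qed
    \<comment> \<open>Subspaces of a Euclidean space are closed, so a dense range is
      everything.\<close>
    moreover have "closed (range ((*v) B))"
      by (intro closed_subspace linear_subspace_image) auto
    ultimately show "surj ((*v) B)"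
      by (auto simp: closure_closed)
  qed
  show "rank A = CARD('n)"
  proof (rule ccontr)
    assume "rank A \<noteq> CARD('n)"
    then obtain z where "z \<noteq> 0" and z: "z v* A = 0"
      using matrix_nonfull_linear_equations_eq[of "transpose A"] by (auto simp: rank_transpose)
    \<comment> \<open>The tolerance is set so that, after pairing with \<open>z\<close>, the errors
      at 0 and at \<open>\<theta>\<^sub>1\<close> together stay below the required increase
      \<open>\<bar>\<theta>\<^sub>1\<bar> * (z \<bullet> z)\<close>, although
      \<open>z \<bullet> f \<theta>\<close> takes equal values at both points.\<close>
    have "0 < \<bar>\<theta>\<^sub>1\<bar> * norm z / 2"
      using P(3) \<open>z \<noteq> 0\<close> by simp
    moreover have "continuous_on P (\<lambda>\<theta>. \<theta> *\<^sub>R z)"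
      by (intro continuous_intros)
    ultimately obtain f where f: "f \<in> R"
      "\<And>\<theta>. \<theta> \<in> P \<Longrightarrow> norm (f \<theta> - \<theta> *\<^sub>R z) < \<bar>\<theta>\<^sub>1\<bar> * norm z / 2"
      using dense by blast
    have ineq: "\<bar>z \<bullet> f \<theta> - \<theta> * (z \<bullet> z)\<bar> < \<bar>\<theta>\<^sub>1\<bar> * (z \<bullet> z) / 2" if "\<theta> \<in> P" for \<theta>
    proof -
      have "\<bar>z \<bullet> f \<theta> - \<theta> * (z \<bullet> z)\<bar> = \<bar>z \<bullet> (f \<theta> - \<theta> *\<^sub>R z)\<bar>"
        by (simp add: inner_diff_right)
      also have "\<dots> \<le> norm z * norm (f \<theta> - \<theta> *\<^sub>R z)"
        by (rule Cauchy_Schwarz_ineq2)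
      also have "\<dots> < norm z * (\<bar>\<theta>\<^sub>1\<bar> * norm z / 2)"
        using \<open>z \<noteq> 0\<close> f(2)[OF that] by (intro mult_strict_left_mono) auto
      also have "\<dots> = \<bar>\<theta>\<^sub>1\<bar> * (z \<bullet> z) / 2"
        by (simp add: dot_square_norm power2_eq_square)
      finally show ?thesis .
    qed
    have "\<bar>\<theta>\<^sub>1 * (z \<bullet> z)\<bar> < \<bar>\<theta>\<^sub>1\<bar> * (z \<bullet> z)"
      using ineq[OF P(1)] ineq[OF P(2)] null[OF f(1) z, of \<theta>\<^sub>1] by linarith
    then show False by (simp add: abs_mult)
  qed
qed

lemma full_rank_if_unif_ens_controllable_disc:
  fixes A :: "real^'n^'n" and B :: "real^'m^'n"
  assumes "unif_ens_controllable_disc P A B" "0 \<in> P" "\<theta>\<^sub>1 \<in> P" "\<theta>\<^sub>1 \<noteq> 0"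
  shows "rank A = CARD('n) \<and> rank B = CARD('n)"
proof -
  let ?R = "{\<lambda>\<theta>. phi_disc A B T \<theta> u | T u. T > 0}"
  have dense: "\<exists>f\<in>?R. \<forall>\<theta>\<in>P. norm (f \<theta> - x \<theta>) < \<epsilon>" if x: "continuous_on P x" "\<epsilon> > 0" for x \<epsilon>
  proof -
    obtain T u where "T > 0" "(SUP \<theta>\<in>P. ereal (norm (phi_disc A B T \<theta> u - x \<theta>))) < ereal \<epsilon>"
      using assms(1)[unfolded unif_ens_controllable_disc_def, rule_format, OF x] by blast
    then show ?thesis
      by (intro bexI[of _ "\<lambda>\<theta>. phi_disc A B T \<theta> u"]) (auto dest: norm_less_of_SUP_ereal_less)
  qed
  \<comment> \<open>The summand \<open>k = 0\<close> carries the last input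
    \<open>u (T - 1)\<close>; all others contain a positive power of
    \<open>\<theta> *\<^sub>R A\<close> and vanish at 0.\<close>
  have at_0: "phi_disc A B T 0 u = B *v u (T - 1)" if "T > 0" for T u
  proof -
    obtain S where T: "T = Suc S" using \<open>T > 0\<close> by (cases T) auto
    show ?thesis
      unfolding phi_disc_def T sum.lessThan_Suc_shift by (simp add: scaleR_matrix_vector_assoc[symmetric])
  qed
  have null: "z \<bullet> phi_disc A B T \<theta> u = z \<bullet> (B *v u (T - 1))" if "T > 0" "z v* A = 0" for T u z \<theta>
  proof -
    obtain S where T: "T = Suc S" using \<open>T > 0\<close> by (cases T) auto
    show ?thesis
      unfolding phi_disc_def T sum.lessThan_Suc_shift inner_add_right inner_sum_right
      by (simp add: inner_matpow_left_null[OF that(2)] del: matpow.simps(2))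
  qed
  have "rank A = CARD('n)" "rank B = CARD('n)"
    by (rule full_rank_if_dense[OF dense _ _ assms(2-4), where A = A and B = B]; auto simp: at_0 null)+
  then show ?thesis by simp
qed

lemma full_rank_if_unif_ens_controllable_cont:
  fixes A :: "real^'n^'n" and B :: "real^'m^'n"
  assumes "unif_ens_controllable_cont P A B" "0 \<in> P" "\<theta>\<^sub>1 \<in> P" "\<theta>\<^sub>1 \<noteq> 0"
  shows "rank A = CARD('n) \<and> rank B = CARD('n)"
proof -
  let ?R = "{\<lambda>\<theta>. phi_cont A B T \<theta> u | T u. u absolutely_integrable_on {0..T}}"
  have dense: "\<exists>f\<in>?R. \<forall>\<theta>\<in>P. norm (f \<theta> - x \<theta>) < \<epsilon>" if x: "continuous_on P x" "\<epsilon> > 0" for x \<epsilon>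
  proof -
    obtain T u where "u absolutely_integrable_on {0..T}"
      "(SUP \<theta>\<in>P. ereal (norm (phi_cont A B T \<theta> u - x \<theta>))) < ereal \<epsilon>"
      using assms(1)[unfolded unif_ens_controllable_cont_def, rule_format, OF x] by blast
    then show ?thesis
      by (intro bexI[of _ "\<lambda>\<theta>. phi_cont A B T \<theta> u"]) (auto dest: norm_less_of_SUP_ereal_less)
  qed
  \<comment> \<open>At parameter 0 the exponential is the identity, and the constant matrix
    \<open>B\<close> leaves the integral.\<close>
  have at_0: "phi_cont A B T 0 u = B *v integral {0..T} u" if "u absolutely_integrable_on {0..T}" for T u
    using integral_linear[OF set_lebesgue_integral_eq_integral(1)[OF that]
        matrix_vector_mul_bounded_linear[of B]]
    by (simp add: phi_cont_def matexp_deriv_0[of A 0, simplified, symmetric] matexp_deriv_at_0 o_def)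
  have "z \<bullet> phi_cont A B T \<theta> u = integral {0..T} (\<lambda>s. z \<bullet> (B *v u s))"
    if "u absolutely_integrable_on {0..T}" "z v* A = 0" for T u z \<theta>
    using integral_linear[OF phi_cont_integrable[OF that(1), of \<theta> A B] bounded_linear_inner_right[of z]]
    by (simp add: phi_cont_def o_def inner_matexp_left_null[OF that(2)])
  \<comment> \<open>The integral just obtained does not involve \<open>\<theta>\<close>, so it can
    be compared with its instance at 0.\<close>
  then have null: "z \<bullet> phi_cont A B T \<theta> u = z \<bullet> phi_cont A B T 0 u"
    if "u absolutely_integrable_on {0..T}" "z v* A = 0" for T u z \<theta>
    using that by simp
  have "rank A = CARD('n)" "rank B = CARD('n)"
    by (rule full_rank_if_dense[OF dense _ _ assms(2-4), where A = A and B = B];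
        auto simp: at_0 intro: null)+
  then show ?thesis by simp
qed

theorem theorem5:
  fixes P :: "real set" and A :: "real^'n^'n" and B :: "real^'m^'n"
  assumes "\<exists>I :: (real \<times> real) set. finite I \<and> (\<forall>(a, b)\<in>I. a \<le> b) \<and> P = (\<Union>(a, b)\<in>I. {a..b})"
    and "closure (interior P) = P"
    and "0 \<in> P"
  shows "(unif_ens_controllable_cont P A B \<longleftrightarrow> rank A = CARD('n) \<and> rank B = CARD('n)) \<and>
         (unif_ens_controllable_disc P A B \<longleftrightarrow> rank A = CARD('n) \<and> rank B = CARD('n))"
proof -
  have compact: "compact P"
    using assms(1) by auto
  \<comment> \<open>The regularity of \<open>P\<close> rules out \<open>{0}\<close>, whose interior
    has empty closure; this supplies the nonzero parameter for the necessity half.\<close>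
  have "interior {0::real} = {}"
    by simp
  then have "P \<noteq> {0}"
    using assms(2) closure_empty by (metis insert_not_empty)
  then have "\<exists>\<theta>. \<theta> \<in> P \<and> \<theta> \<noteq> 0"
    using assms(3) by (auto simp: set_eq_iff)
  then obtain \<theta>\<^sub>1 where \<theta>\<^sub>1: "\<theta>\<^sub>1 \<in> P" "\<theta>\<^sub>1 \<noteq> 0"
    by blast
  show ?thesis
  proof (intro conjI iffI)
    assume "rank A = CARD('n) \<and> rank B = CARD('n)"
    then have "surj ((*v) A)" "surj ((*v) B)"
      by (simp_all add: full_rank_surjective)
    then show "unif_ens_controllable_cont P A B" "unif_ens_controllable_disc P A B"
      using compact unif_ens_controllable_cont_if_surj unif_ens_controllable_disc_if_surj by auto
  qed (use full_rank_if_unif_ens_controllable_cont[OF _ assms(3) \<theta>\<^sub>1, of A B]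
      full_rank_if_unif_ens_controllable_disc[OF _ assms(3) \<theta>\<^sub>1, of A B] in auto)
qed

end
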